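(* Let $H$ be a finite simple $2$-connected subcubic graph, let $e=uv\in E(H)$, and let $d$ be a real number. If $\mathrm{def}(H,e)\le d$, then $H-e$ admits a walk from $u$ to $v$ visiting every vertex of $H$, of length at most $$\frac{5n(H)+n_2(H)}{4}+d-1 .$$
   Context: A graph is subcubic if its maximum degree is at most $3$; "$2$-connected" means $2$-vertex-connected (in particular with at least $3$ vertices). $n(H)=|V(H)|$ and $n_2(H)$ is the number of degree-$2$ vertices of $H$. An even cover of $H$ is a spanning subgraph $F$ of $H$ in which every vertex has degree $0$ or $2$; its excess is $\mathrm{exc}(F)=2\cdot(\text{number of cycles of }F)+(\text{number of isolated vertices of }F)$. For an edge $e$, $\mathcal E(H,e)$ is the set of even covers of $H$ containing $e$, $\mathrm{exc}_e(H):=\min_{F\in\mathcal E(H,e)}\mathrm{exc}(F)-2$, and the rooted-excess deficit is $\mathrm{def}(H,e):=\mathrm{exc}_e(H)-\frac{n(H)+n_2(H)}{4}$. The length of a walk is its number of edges counted with repetition; walks may repeat vertices and edges. *)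

theory Defs
  imports Complex_Main "Graph_Theory.Graph_Theory"
begin

text \<open>
  A finite simple graph is a \<open>pair_graph\<close>: a finite, loop-free, symmetric set of arcs, an
  undirected edge \<open>uv\<close> being the two arcs \<open>(u, v)\<close> and \<open>(v, u)\<close>. Hence the degree
  of a vertex is its out-degree. Below, an edge is passed as either one of its two arcs.
\<close>

definition degree :: "'a pair_pre_digraph \<Rightarrow> 'a \<Rightarrow> nat" where
  "degree G x = out_degree (with_proj G) x"

definition subcubic :: "'a pair_pre_digraph \<Rightarrow> bool" where
  "subcubic G \<longleftrightarrow> (\<forall>x \<in> pverts G. degree G x \<le> 3)"

definition two_connected :: "'a pair_pre_digraph \<Rightarrow> bool" where
  "two_connected G \<longleftrightarrow>
     3 \<le> card (pverts G) \<and>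
     Digraph_Component.connected (with_proj G) \<and>
     (\<forall>x \<in> pverts G. Digraph_Component.connected (pre_digraph.del_vert (with_proj G) x))"

definition num_verts :: "'a pair_pre_digraph \<Rightarrow> nat" where
  "num_verts G = card (pverts G)"

definition num_deg2 :: "'a pair_pre_digraph \<Rightarrow> nat" where
  "num_deg2 G = card {x \<in> pverts G. degree G x = 2}"

definition del_edge :: "'a pair_pre_digraph \<Rightarrow> 'a \<times> 'a \<Rightarrow> 'a pair_pre_digraph" where
  "del_edge G e = G\<lparr>parcs := parcs G - {e}\<^sup>s\<rparr>"

text \<open>
  The undirected cycles of \<open>G\<close>, each given by its edge set. The closed walks going back and
  forth along one edge, which are cycles of the symmetric digraph, are excluded by the length
  bound; taking the symmetric closure identifies the closed walks that traverse the same cycle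
  from different starting vertices or in opposite directions.
\<close>

definition ucycles :: "'a pair_pre_digraph \<Rightarrow> 'a rel set" where
  "ucycles G = {(set p)\<^sup>s | p. pre_digraph.cycle (with_proj G) p \<and> 3 \<le> length p}"

definition even_cover :: "'a pair_pre_digraph \<Rightarrow> 'a pair_pre_digraph \<Rightarrow> bool" where
  "even_cover H F \<longleftrightarrow>
     pair_graph F \<and> spanning (with_proj F) (with_proj H) \<and>
     (\<forall>x \<in> pverts F. degree F x = 0 \<or> degree F x = 2)"

definition exc :: "'a pair_pre_digraph \<Rightarrow> nat" where
  "exc F = 2 * card (ucycles F) + card {x \<in> pverts F. degree F x = 0}"

definition even_covers_with :: "'a pair_pre_digraph \<Rightarrow> 'a \<times> 'a \<Rightarrow> 'a pair_pre_digraph set" where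
  "even_covers_with H e = {F. even_cover H F \<and> e \<in> parcs F}"

definition rooted_exc :: "'a pair_pre_digraph \<Rightarrow> 'a \<times> 'a \<Rightarrow> int" where
  "rooted_exc H e = int (Min (exc ` even_covers_with H e)) - 2"

definition deficit :: "'a pair_pre_digraph \<Rightarrow> 'a \<times> 'a \<Rightarrow> real" where
  "deficit H e = real_of_int (rooted_exc H e) - (real (num_verts H) + real (num_deg2 H)) / 4"

end

theory Submission
  imports Defs
begin

text \<open>
  Take an even cover \<open>F\<close> containing \<open>uv\<close> of minimum excess; one exists because \<open>uv\<close> lies on a
  cycle of the 2-connected graph \<open>H\<close>. The cycle of \<open>F\<close> through \<open>uv\<close>, with \<open>uv\<close> removed, is a walk
  from \<open>u\<close> to \<open>v\<close>. While the set of visited vertices, a union of components of \<open>F\<close>, is not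
  everything, some edge \<open>xy\<close> of \<open>H\<close> leaves it, and the walk is extended by the detour that goes from
  \<open>x\<close> to \<open>y\<close>, once around the component of \<open>y\<close> in \<open>F\<close>, and back to \<open>x\<close>. A detour costs two edges more
  than the size of a cycle and one edge more than the size of an isolated vertex, which is exactly what
  that component contributes to the excess. Hence the final walk has length at most
  \<open>n(H) + exc(F) - 3\<close>.
\<close>

lemma symcl_iff: "(a, b) \<in> R\<^sup>s \<longleftrightarrow> (a, b) \<in> R \<or> (b, a) \<in> R"
  by (auto simp: symcl_def)

lemma (in pair_sym_digraph) symcl_subset_parcs_iff: "R\<^sup>s \<subseteq> parcs G \<longleftrightarrow> R \<subseteq> parcs G"
  by (auto simp: symcl_def intro: arcs_symmetric)

lemma degree_eq_card_Image: "degree G x = card (parcs G `` {x})"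
proof -
  have "bij_betw snd (out_arcs (with_proj G) x) (parcs G `` {x})"
    by (auto simp: bij_betw_def out_arcs_def inj_on_def image_iff)
  then show ?thesis
    unfolding degree_def out_degree_def by (rule bij_betw_same_card)
qed

section \<open>Walks as vertex lists\<close>

lemma vwalk_arcs_split: "vwalk_arcs (xs @ x # ys) = vwalk_arcs (xs @ [x]) @ vwalk_arcs (x # ys)"
  by (induction xs rule: vwalk_arcs.induct) auto

lemma vwalk_arcs_subset: "set (vwalk_arcs xs) \<subseteq> set xs \<times> set xs"
  by (auto elim: in_set_vwalk_arcsE)

text \<open>Membership in \<open>S\<close> propagates backwards along the walk, so a visit to
  \<open>S\<close> would force the first vertex into \<open>S\<close>. This keeps a new cycle of
  \<open>F\<close> away from the visited set.\<close>

lemma vwalk_disjoint: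
  assumes "xs \<noteq> []" "hd xs \<notin> S" "\<And>a b. (a, b) \<in> set (vwalk_arcs xs) \<Longrightarrow> b \<in> S \<Longrightarrow> a \<in> S"
  shows "S \<inter> set xs = {}"
  using assms
proof (induction xs rule: vwalk_arcs.induct)
  case (3 a b xs)
  have "b \<notin> S"
    using 3(3) 3(4)[of a b] by auto
  then have "S \<inter> set (b # xs) = {}"
    using 3(4) by (intro 3(1)) auto
  then show ?case
    using 3(3) by simp
qed auto

lemma pcas_vwalk_arcs: "xs \<noteq> [] \<Longrightarrow> pcas (hd xs) (vwalk_arcs xs) (last xs)"
  by (induction xs rule: vwalk_arcs.induct) auto

lemma pawalk_verts_vwalk_arcs: "xs \<noteq> [] \<Longrightarrow> pawalk_verts (hd xs) (vwalk_arcs xs) = xs"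
  by (induction xs rule: vwalk_arcs.induct) auto

lemma length_vwalk_arcs: "length (vwalk_arcs xs) = length xs - 1"
  by (induction xs rule: vwalk_arcs.induct) auto

lemma awalk_vwalk_arcs:
  assumes "xs \<noteq> []" "hd xs \<in> pverts G" "set (vwalk_arcs xs) \<subseteq> parcs G"
  shows "pre_digraph.awalk (with_proj G) (hd xs) (vwalk_arcs xs) (last xs)"
  using assms
  by (simp add: pre_digraph.awalk_def cas_with_proj_eq pcas_vwalk_arcs)

section \<open>Cycles as vertex lists\<close>

text \<open>The symmetric closure matches the encoding in \<open>ucycles\<close>. For
  \<open>c = []\<close> the closed list has a single entry and yields no arc.\<close>

definition cycle_arcs :: "'a list \<Rightarrow> 'a rel" where
  "cycle_arcs c = (set (vwalk_arcs (c @ [hd c])))\<^sup>s"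

text \<open>Cutting both closed walks at \<open>x\<close> and at the head of \<open>xs\<close> gives
  the same two paths, in opposite order.\<close>

lemma cycle_arcs_rotate: "cycle_arcs (xs @ x # ys) = cycle_arcs (x # ys @ xs)"
proof (cases xs)
  case (Cons z zs)
  then show ?thesis
    using vwalk_arcs_split[of "z # zs" x "ys @ [z]"] vwalk_arcs_split[of "x # ys" z "zs @ [x]"]
    by (auto simp: cycle_arcs_def symcl_iff)
qed (simp add: cycle_arcs_def)

lemma cycle_arcs_subset: "cycle_arcs c \<subseteq> set c \<times> set c"
proof (cases "c = []")
  case False
  then have "set (c @ [hd c]) = set c"
    by (simp add: insert_absorb)
  then show ?thesis
    using vwalk_arcs_subset[of "c @ [hd c]"] unfolding cycle_arcs_def symcl_def by auto
qed (simp add: cycle_arcs_def symcl_def)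

text \<open>Rotate \<open>s\<close> to the front: its neighbours are then the second and the last
  vertex, which differ because the length is at least 3.\<close>

lemma card_cycle_arcs_Image:
  assumes "3 \<le> length c" "distinct c" "s \<in> set c"
  shows "card (cycle_arcs c `` {s}) = 2"
proof -
  obtain xs ys where c: "c = xs @ s # ys"
    using assms(3) by (auto simp: in_set_conv_decomp)
  have "2 \<le> length (ys @ xs)"
    using assms(1) c by simp
  then obtain a l where l: "ys @ xs = a # l" "l \<noteq> []"
    by (cases "ys @ xs"; cases "tl (ys @ xs)") auto
  then obtain m b where m: "ys @ xs = a # m @ [b]"
    by (metis append_butlast_last_id)
  have *: "s \<notin> set (ys @ xs)" "distinct (ys @ xs)"
    using assms(2) c by auto
  have "vwalk_arcs (s # (a # m @ [b]) @ [s]) = (s, a) # vwalk_arcs (a # m @ [b]) @ [(b, s)]"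
    using vwalk_arcs_split[of "a # m" b "[s]"] by simp
  then have "cycle_arcs c = (insert (s, a) (insert (b, s) (set (vwalk_arcs (ys @ xs)))))\<^sup>s"
    unfolding c cycle_arcs_rotate m by (simp add: cycle_arcs_def m insert_commute)
  then have "cycle_arcs c `` {s} = {a, b}"
    using vwalk_arcs_subset[of "ys @ xs"] * m by (auto simp: symcl_iff)
  moreover have "a \<noteq> b"
    using * m by auto
  ultimately show ?thesis by simp
qed

lemma (in pair_wf_digraph) cycle_vertices_subset_pverts:
  assumes "3 \<le> length c" "distinct c" "cycle_arcs c \<subseteq> parcs G"
  shows "set c \<subseteq> pverts G"
proof
  fix a assume "a \<in> set c"
  then have "cycle_arcs c `` {a} \<noteq> {}"
    using card_cycle_arcs_Image[OF assms(1,2)] by fastforce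
  then show "a \<in> pverts G"
    using assms(3) in_arcsD1 by blast
qed

lemma ucycleI:
  assumes "pair_graph G" "3 \<le> length c" "distinct c" "cycle_arcs c \<subseteq> parcs G"
  shows "cycle_arcs c \<in> ucycles G"
proof -
  interpret pair_graph G by fact
  let ?p = "vwalk_arcs (c @ [hd c])"
  from assms(2) have ne: "c \<noteq> []" by auto
  have sub: "set ?p \<subseteq> parcs G"
    using assms(4) symcl_subset_parcs_iff by (simp add: cycle_arcs_def)
  have "(hd c, hd (tl c @ [hd c])) \<in> set ?p"
    using ne by (cases c) auto
  then have "hd c \<in> pverts G"
    using sub in_arcsD1 by blast
  then have "pre_digraph.awalk (with_proj G) (hd c) ?p (hd c)"
    using awalk_vwalk_arcs[of "c @ [hd c]" G] sub ne by simp
  \<comment> \<open>The vertex list of \<open>?p\<close> is \<open>c @ [hd c]\<close>;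
    \<open>tl\<close> drops one of the two copies of \<open>hd c\<close>.\<close>
  moreover have "distinct (tl (pawalk_verts (hd c) ?p))"
    using pawalk_verts_vwalk_arcs[of "c @ [hd c]"] ne assms(3) by (cases c) auto
  moreover have "?p \<noteq> []" "3 \<le> length ?p"
    using assms(2) length_vwalk_arcs[of "c @ [hd c]"] by auto
  ultimately show ?thesis
    unfolding ucycles_def cycle_arcs_def pre_digraph.cycle_def awalk_verts_with_proj_eq by blast
qed

lemma finite_ucycles:
  assumes "pair_graph G"
  shows "finite (ucycles G)"
proof -
  interpret pair_graph G by fact
  have "ucycles G \<subseteq> Pow (parcs G)"
    by (auto simp: ucycles_def pre_digraph.cycle_def pre_digraph.awalk_def symcl_subset_parcs_iff)
       (metis arcs_symmetric subsetD symcl_iff)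
  then show ?thesis
    using finite_subset pair_finite_arcs by blast
qed

section \<open>Graphs with all degrees 0 or 2\<close>

text \<open>
  A longest path ending with the arc \<open>(z, y)\<close> starts at a vertex \<open>w\<close> both of whose neighbours lie on
  it. Inner vertices have both their neighbours on the path already, so the second neighbour of \<open>w\<close>
  can only be \<open>y\<close>.
\<close>

lemma cycle_through_arc:
  assumes "pair_graph F" and deg: "\<And>x. x \<in> pverts F \<Longrightarrow> degree F x = 0 \<or> degree F x = 2"
    and yz: "(y, z) \<in> parcs F"
  obtains c where "3 \<le> length c" "distinct c" "cycle_arcs c \<subseteq> parcs F" "hd c = y" "last c = z"
proof -
  interpret F: pair_graph F by fact
  have deg2: "card (parcs F `` {a}) = 2" if "(a, b) \<in> parcs F" for a b
  proof -
    have "finite (parcs F `` {a})"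
      using F.pair_finite_arcs by (rule finite_Image)
    then have "card (parcs F `` {a}) \<noteq> 0"
      using that by auto
    then show ?thesis
      using deg[of a] that F.in_arcsD1 by (auto simp: degree_eq_card_Image)
  qed
  \<comment> \<open>The path meant is \<open>ws @ [y]\<close>. Its last arc \<open>(z, y)\<close>
    stays fixed, and it can only grow at the front.\<close>
  define P where "P ws \<longleftrightarrow> ws \<noteq> [] \<and> last ws = z \<and> distinct (ws @ [y]) \<and> set ws \<subseteq> pverts F \<and>
    set (vwalk_arcs (ws @ [y])) \<subseteq> parcs F" for ws
  have "P [z]"
    using yz F.in_arcsD2 F.no_loops' F.arcs_symmetric by (auto simp: P_def)
  moreover have "\<forall>ws. P ws \<longrightarrow> length ws < Suc (card (pverts F))"
  proof (intro allI impI)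
    fix ws assume "P ws"
    then have "length ws = card (set ws)" "set ws \<subseteq> pverts F"
      by (simp_all add: P_def distinct_card)
    then show "length ws < Suc (card (pverts F))"
      using card_mono[OF F.pair_finite_verts] by (simp add: less_Suc_eq_le)
  qed
  ultimately have "\<exists>ws. P ws \<and> (\<forall>ws'. P ws' \<longrightarrow> length ws' \<le> length ws)"
    by (rule Lattices_Big.ex_has_greatest_nat)
  then obtain ws where ws: "P ws" and max: "\<And>ws'. P ws' \<Longrightarrow> length ws' \<le> length ws"
    by blast
  from ws obtain w ws' where w: "ws = w # ws'"
    unfolding P_def by (cases ws) auto
  define x where "x = hd (ws' @ [y])"
  have wx: "(w, x) \<in> parcs F"
    using ws unfolding P_def w x_def by auto
  then obtain w' where w': "w' \<noteq> x" "(w, w') \<in> parcs F"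
    using deg2[OF wx] by (auto simp: card_2_iff set_eq_iff)
  have "w' \<in> set (ws @ [y])"
  proof (rule ccontr)
    assume "w' \<notin> set (ws @ [y])"
    then have "P (w' # ws)"
      using ws w' F.in_arcsD2 F.arcs_symmetric unfolding P_def by (auto simp: w)
    then show False
      using max by fastforce
  qed
  moreover have "w' \<noteq> w"
    using w' F.no_loops' by blast
  ultimately have w'_in: "w' \<in> set (ws' @ [y])"
    by (simp add: w)
  have "w' = y"
  proof (rule ccontr)
    assume "w' \<noteq> y"
    obtain k l where kl: "ws' @ [y] = k @ w' # l"
      using w'_in by (meson split_list)
    \<comment> \<open>As \<open>w'\<close> is not \<open>x\<close>, its predecessor \<open>p\<close>
      on the path differs from \<open>w\<close>; hence \<open>w\<close>, \<open>p\<close>,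
      \<open>q\<close> will be three neighbours of \<open>w'\<close>.\<close>
    have "k \<noteq> []"
      using kl w'(1) by (auto simp: x_def)
    then obtain k' p where k: "k = k' @ [p]"
      by (metis append_butlast_last_id)
    have "l \<noteq> []"
      using kl \<open>w' \<noteq> y\<close> by auto
    then obtain q l' where l: "l = q # l'"
      by (cases l) auto
    have split: "ws @ [y] = (w # k') @ p # w' # q # l'"
      using kl k l by (simp add: w)
    have "(p, w') \<in> parcs F" "(w', q) \<in> parcs F"
      using ws vwalk_arcs_split[of "w # k'" p "w' # q # l'"] unfolding P_def split by auto
    then have "{w, p, q} \<subseteq> parcs F `` {w'}"
      using w' F.arcs_symmetric by blast
    moreover have "card {w, p, q} = 3"
      using ws unfolding P_def split by auto
    ultimately have "3 \<le> card (parcs F `` {w'})"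
      by (metis card_mono finite_Image F.pair_finite_arcs)
    moreover have "card (parcs F `` {w'}) = 2"
      using deg2 \<open>(w', q) \<in> parcs F\<close> by blast
    ultimately show False by simp
  qed
  with w' have "(y, w) \<in> parcs F" "x \<noteq> y"
    using F.arcs_symmetric by auto
  show thesis
  \<comment> \<open>The arc \<open>(y, w)\<close> closes the path. Since
    \<open>x \<noteq> y\<close>, the list \<open>ws\<close> has at least two entries, so this is not
    one edge traversed back and forth.\<close>
  proof (rule that[of "y # ws"])
    show "3 \<le> length (y # ws)"
      using \<open>x \<noteq> y\<close> w by (cases ws') (auto simp: x_def)
    show "cycle_arcs (y # ws) \<subseteq> parcs F"
      using ws \<open>(y, w) \<in> parcs F\<close> F.symcl_subset_parcs_iff
      unfolding cycle_arcs_def P_def w by simp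
  qed (use ws in \<open>auto simp: P_def\<close>)
qed

text \<open>The cycle already supplies the two neighbours that the degree allows, so its vertex set
  is a whole component of \<open>F\<close>.\<close>

lemma cycle_vertices_closed:
  assumes "pair_graph F" and deg: "\<And>x. x \<in> pverts F \<Longrightarrow> degree F x = 0 \<or> degree F x = 2"
    and c: "3 \<le> length c" "distinct c" "cycle_arcs c \<subseteq> parcs F"
    and ab: "(a, b) \<in> parcs F" "a \<in> set c"
  shows "b \<in> set c"
proof -
  interpret F: pair_graph F by fact
  have fin: "finite (parcs F `` {a})"
    using F.pair_finite_arcs by (rule finite_Image)
  have "cycle_arcs c `` {a} \<subseteq> parcs F `` {a}"
    using c(3) by blast
  moreover have "card (parcs F `` {a}) \<le> card (cycle_arcs c `` {a})"
    using deg[of a] F.in_arcsD1[OF ab(1)] card_cycle_arcs_Image[OF c(1,2) ab(2)]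
    by (auto simp: degree_eq_card_Image)
  ultimately have "cycle_arcs c `` {a} = parcs F `` {a}"
    using fin card_seteq by blast
  then show ?thesis
    using ab(1) cycle_arcs_subset[of c] by blast
qed

section \<open>Connectivity\<close>

text \<open>If no such arc existed, everything reachable from \<open>S\<close> in the symmetric
  closure would stay in \<open>S\<close>.\<close>

lemma connected_crossing_arc:
  assumes "Digraph_Component.connected G" "S \<subseteq> verts G" "S \<noteq> {}" "S \<noteq> verts G"
  obtains x y where "(x, y) \<in> (arcs_ends G)\<^sup>s" "x \<in> S" "y \<in> verts G" "y \<notin> S"
proof -
  obtain a b where ab: "a \<in> S" "b \<in> verts G" "b \<notin> S"
    using assms by blast
  then have "(a, b) \<in> rtrancl_on (verts G) ((arcs_ends G)\<^sup>s)"
    using assms by (auto simp: connected_conv)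
  then have "b \<in> S" if "\<And>x y. (x, y) \<in> (arcs_ends G)\<^sup>s \<Longrightarrow> x \<in> S \<Longrightarrow> y \<in> verts G \<Longrightarrow> y \<in> S"
  proof (induction rule: rtrancl_on_induct)
    case (step x y)
    then show ?case using that by blast
  qed (use ab in auto)
  then show thesis
    using ab that by blast
qed

lemma (in pair_graph) arcs_ends_del_vert:
  "arcs_ends (pre_digraph.del_vert (with_proj G) x) = {(a, b) \<in> parcs G. a \<noteq> x \<and> b \<noteq> x}"
  by (auto simp: arcs_ends_conv del_vert_simps)

text \<open>Connectivity without \<open>v\<close> gives \<open>u\<close> a second neighbour
  \<open>y\<close>; connectivity without \<open>u\<close> gives a path from \<open>v\<close> to
  \<open>y\<close>. Prefixing \<open>u\<close> to that path gives the cycle.\<close>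

lemma two_connected_cycle_through_edge:
  assumes "pair_graph H" "two_connected H" and uv: "(u, v) \<in> parcs H"
  obtains c where "3 \<le> length c" "distinct c" "set c \<subseteq> pverts H" "cycle_arcs c \<subseteq> parcs H"
    "(u, v) \<in> cycle_arcs c"
proof -
  interpret H: pair_graph H by fact
  have verts: "u \<in> pverts H" "v \<in> pverts H" "u \<noteq> v"
    using uv H.in_arcsD1 H.in_arcsD2 H.no_loops' by auto
  let ?Hu = "pre_digraph.del_vert (with_proj H) u"
  let ?Hv = "pre_digraph.del_vert (with_proj H) v"
  have con: "Digraph_Component.connected ?Hu" "Digraph_Component.connected ?Hv"
    using assms(2) verts by (auto simp: two_connected_def)
  \<comment> \<open>A third vertex makes \<open>{u}\<close> a proper part of \<open>?Hv\<close>, so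
    some arc leaves it.\<close>
  have "\<not> pverts H \<subseteq> {u, v}"
    using card_mono[of "{u, v}" "pverts H"] verts assms(2) by (auto simp: two_connected_def)
  then have "{u} \<noteq> pverts H - {v}"
    by blast
  then obtain x y where "(x, y) \<in> (arcs_ends ?Hv)\<^sup>s" "x \<in> {u}"
    using connected_crossing_arc[OF con(2), of "{u}"] verts
    by (simp add: pre_digraph.del_vert_simps) blast
  then have y: "(y, u) \<in> parcs H" "y \<noteq> v"
    using H.arcs_symmetric by (auto simp: symcl_iff H.arcs_ends_del_vert)
  have "y \<in> pverts H" "y \<noteq> u"
    using y H.in_arcsD1 H.no_loops' by auto
  interpret Hu: wf_digraph ?Hu
    by (rule H.wf_digraph_del_vert)
  have "symmetric ?Hu"
    using H.arcs_symmetric by (simp add: symmetric_def H.arcs_ends_del_vert sym_def)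
  then have "strongly_connected ?Hu"
    using con(1) Hu.symmetric_connected_imp_strongly_connected by blast
  then have "v \<rightarrow>\<^sup>*\<^bsub>?Hu\<^esub> y"
    using verts \<open>y \<in> pverts H\<close> \<open>y \<noteq> u\<close> by (auto simp: strongly_connected_def pre_digraph.del_vert_simps)
  then obtain p where p: "vpath p ?Hu" "hd p = v" "last p = y"
    using Hu.reachable_vpath_conv by blast
  then have set_p: "p \<noteq> []" "distinct p" "set p \<subseteq> pverts H - {u}" "set (vwalk_arcs p) \<subseteq> parcs H"
    by (auto simp: vpath_def vwalk_def pre_digraph.del_vert_simps H.arcs_ends_del_vert)
  have "2 \<le> length p"
    using p(2,3) \<open>y \<noteq> v\<close> set_p(1) by (cases p rule: vwalk_arcs.cases) auto
  have arcs: "set (vwalk_arcs ((u # p) @ [u])) = {(u, v), (y, u)} \<union> set (vwalk_arcs p)"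
    using set_p(1) p(2,3) by (auto simp: set_vwalk_arcs_snoc)
  show thesis
  proof (rule that[of "u # p"])
    show "cycle_arcs (u # p) \<subseteq> parcs H"
      using set_p uv y(1) H.symcl_subset_parcs_iff arcs by (simp add: cycle_arcs_def)
    show "(u, v) \<in> cycle_arcs (u # p)"
      using arcs by (simp add: cycle_arcs_def symcl_iff)
  qed (use set_p verts \<open>2 \<le> length p\<close> in auto)
qed

text \<open>A cycle through \<open>uv\<close>, with all other vertices isolated, is an even cover.
  This makes the \<open>Min\<close> in \<open>rooted_exc\<close> range over a nonempty set.\<close>

lemma two_connected_even_covers_with:
  assumes "pair_graph H" "two_connected H" "(u, v) \<in> parcs H"
  shows "even_covers_with H (u, v) \<noteq> {}"
proof -
  interpret H: pair_graph H by fact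
  obtain c where c: "3 \<le> length c" "distinct c" "set c \<subseteq> pverts H" "cycle_arcs c \<subseteq> parcs H"
    "(u, v) \<in> cycle_arcs c"
    using two_connected_cycle_through_edge[OF assms] by blast
  define F where "F = \<lparr>pverts = pverts H, parcs = cycle_arcs c\<rparr>"
  have "pair_graph F"
  proof
    show "finite (parcs F)"
      using finite_subset[OF c(4) H.pair_finite_arcs] by (simp add: F_def)
    show "symmetric F"
      unfolding symmetric_def F_def cycle_arcs_def by (simp add: sym_def symcl_iff disj_commute)
  qed (use c(4) H.in_arcsD1 H.in_arcsD2 H.no_loops' H.pair_finite_verts in \<open>auto simp: F_def\<close>)
  then interpret F: pair_graph F .
  have "spanning (with_proj F) (with_proj H)"
    using c(4) F.wf_digraph_axioms H.wf_digraph_axioms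
    by (auto simp: spanning_def subgraph_def compatible_def F_def)
  moreover have "degree F x = 0 \<or> degree F x = 2" for x
  proof (cases "x \<in> set c")
    case False
    then have "cycle_arcs c `` {x} = {}"
      using cycle_arcs_subset[of c] by blast
    then show ?thesis
      by (simp add: degree_eq_card_Image F_def)
  qed (simp add: card_cycle_arcs_Image[OF c(1,2)] degree_eq_card_Image F_def)
  ultimately have "F \<in> even_covers_with H (u, v)"
    using \<open>pair_graph F\<close> c(5) by (auto simp: even_covers_with_def even_cover_def F_def)
  then show ?thesis by blast
qed

text \<open>A spanning subgraph is determined by its arc set. Finiteness lets the \<open>Min\<close>
  in \<open>rooted_exc\<close> be attained.\<close>

lemma finite_even_covers_with:
  assumes "pair_graph H"
  shows "finite (even_covers_with H e)"
proof -
  interpret H: pair_graph H by fact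
  have "even_covers_with H e \<subseteq> (\<lambda>A. \<lparr>pverts = pverts H, parcs = A\<rparr>) ` Pow (parcs H)"
  proof
    fix F assume "F \<in> even_covers_with H e"
    then have "pverts F = pverts H" "parcs F \<subseteq> parcs H"
      by (auto simp: even_covers_with_def even_cover_def spanning_def subgraph_def)
    then show "F \<in> (\<lambda>A. \<lparr>pverts = pverts H, parcs = A\<rparr>) ` Pow (parcs H)"
      by (intro image_eqI[of _ _ "parcs F"]) auto
  qed
  then show ?thesis
    using H.pair_finite_arcs finite_subset by blast
qed

section \<open>The spanning walk\<close>

text \<open>The share of \<open>exc F\<close> carried by the visited set \<open>S\<close>, so that
  the length bound can be an invariant of the growing walk.\<close>

definition exc_within :: "'a pair_pre_digraph \<Rightarrow> 'a set \<Rightarrow> nat" where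
  "exc_within F S = 2 * card {C \<in> ucycles F. C \<subseteq> S \<times> S} + card {x \<in> S. degree F x = 0}"

lemma exc_within_pverts_le:
  assumes "pair_graph F"
  shows "exc_within F (pverts F) \<le> exc F"
  using card_mono[OF finite_ucycles[OF assms], of "{C \<in> ucycles F. C \<subseteq> pverts F \<times> pverts F}"]
  by (auto simp: exc_within_def exc_def)

lemma exc_within_insert:
  assumes "pair_graph F" "finite S" "y \<notin> S" "degree F y = 0"
  shows "exc_within F S + 1 \<le> exc_within F (insert y S)"
proof -
  have "{x \<in> insert y S. degree F x = 0} = insert y {x \<in> S. degree F x = 0}"
    using assms by auto
  moreover have "card {C \<in> ucycles F. C \<subseteq> S \<times> S} \<le>
      card {C \<in> ucycles F. C \<subseteq> insert y S \<times> insert y S}"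
    using finite_ucycles[OF assms(1)] by (intro card_mono) auto
  ultimately show ?thesis
    using assms by (simp add: exc_within_def)
qed

text \<open>The cycle \<open>c\<close> has arcs and avoids \<open>S\<close>, so it is not yet
  counted for \<open>S\<close>.\<close>

lemma exc_within_cycle:
  assumes "pair_graph F" "finite S" "S \<inter> set c = {}"
    and c: "3 \<le> length c" "distinct c" "cycle_arcs c \<subseteq> parcs F"
  shows "exc_within F S + 2 \<le> exc_within F (S \<union> set c)"
proof -
  let ?C = "\<lambda>S. {C \<in> ucycles F. C \<subseteq> S \<times> S}"
  have fin: "finite (?C T)" for T
    using finite_ucycles[OF assms(1)] by simp
  have "cycle_arcs c `` {hd c} \<noteq> {}"
    using card_cycle_arcs_Image[OF c(1,2), of "hd c"] c(1) by (cases c) auto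
  then have "\<not> cycle_arcs c \<subseteq> S \<times> S"
    using cycle_arcs_subset[of c] assms(3) by blast
  then have "card (?C S) + 1 = card (insert (cycle_arcs c) (?C S))"
    using fin by simp
  also have "\<dots> \<le> card (?C (S \<union> set c))"
  proof (rule card_mono[OF fin])
    have "cycle_arcs c \<in> ?C (S \<union> set c)"
      using ucycleI[OF assms(1) c] cycle_arcs_subset[of c] by blast
    moreover have "?C S \<subseteq> ?C (S \<union> set c)"
      by blast
    ultimately show "insert (cycle_arcs c) (?C S) \<subseteq> ?C (S \<union> set c)"
      by simp
  qed
  finally have "card (?C S) + 1 \<le> card (?C (S \<union> set c))" .
  moreover have "card {x \<in> S. degree F x = 0} \<le> card {x \<in> S \<union> set c. degree F x = 0}"
    using assms(2) by (intro card_mono) auto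
  ultimately show ?thesis
    by (simp add: exc_within_def)
qed

lemma even_cover_spanning_walk:
  assumes "pair_graph H" "Digraph_Component.connected (with_proj H)" "even_cover H F"
    and uv: "(u, v) \<in> parcs F"
  obtains ws where "ws \<noteq> []" "hd ws = u" "last ws = v" "set ws = pverts H"
    "set (vwalk_arcs ws) \<subseteq> parcs H - {(u, v), (v, u)}"
    "length ws + 2 \<le> num_verts H + exc F"
proof -
  interpret H: pair_graph H by fact
  have F: "pair_graph F" and deg: "\<And>x. x \<in> pverts F \<Longrightarrow> degree F x = 0 \<or> degree F x = 2"
    and FH: "pverts F = pverts H" "parcs F \<subseteq> parcs H"
    using assms(3) by (auto simp: even_cover_def spanning_def subgraph_def)
  interpret F: pair_graph F by fact
  define A where "A = parcs H - {(u, v), (v, u)}"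
  \<comment> \<open>A list of \<open>k\<close> vertices is a walk of length \<open>k - 1\<close>; the \<open>+ 2\<close> compensates for the cycle
    through \<open>uv\<close>, which is walked without a detour.\<close>
  define good where "good S ws \<longleftrightarrow> S \<subseteq> pverts H \<and> parcs F `` S \<subseteq> S \<and> u \<in> S \<and> v \<in> S \<and>
    ws \<noteq> [] \<and> hd ws = u \<and> last ws = v \<and> set ws = S \<and> set (vwalk_arcs ws) \<subseteq> A \<and>
    length ws + 2 \<le> card S + exc_within F S" for S ws
  have start: "\<exists>S ws. good S ws"
  proof -
    obtain c where c: "3 \<le> length c" "distinct c" "cycle_arcs c \<subseteq> parcs F" "hd c = u" "last c = v"
      using cycle_through_arc[OF F deg uv] by blast
    obtain x y l where xyl: "c = u # x # y # l"
      using c(1,4) by (cases c rule: vwalk_arcs.cases; cases "tl (tl c)") auto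
    have "c = butlast c @ [v]"
      using c(5) xyl by (metis append_butlast_last_id list.distinct(1))
    then obtain m where m: "c = u # m @ [v]" "m \<noteq> []"
      using xyl by (cases "butlast c") auto
    have "set c \<subseteq> pverts H"
      using F.cycle_vertices_subset_pverts[OF c(1-3)] FH(1) by simp
    moreover have "parcs F `` set c \<subseteq> set c"
      using cycle_vertices_closed[OF F deg c(1-3)] by blast
    \<comment> \<open>The vertices \<open>u\<close> and \<open>v\<close> occur only at the two ends
      of \<open>c\<close>, with \<open>m\<close> nonempty in between, so they are never
      consecutive.\<close>
    moreover have "set (vwalk_arcs c) \<subseteq> A"
    proof -
      have "set (vwalk_arcs c) \<subseteq> parcs F"
        using c(3) set_vwalk_arcs_append1[of c "[hd c]"] F.symcl_subset_parcs_iff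
        by (auto simp: cycle_arcs_def)
      moreover have "vwalk_arcs c = (u, hd m) # vwalk_arcs (m @ [v])"
        using m by simp
      moreover have "vwalk_arcs (m @ [v]) = vwalk_arcs m @ [(last m, v)]"
        using vwalk_arcs_append[OF m(2), of "[v]"] by simp
      moreover have "hd m \<noteq> v" "last m \<noteq> u" "u \<notin> set m" "v \<notin> set m" "u \<noteq> v"
        using c(2) m by (auto dest: hd_in_set last_in_set)
      ultimately show ?thesis
        using FH(2) vwalk_arcs_subset[of m] unfolding A_def by auto
    qed
    moreover have "length c + 2 \<le> card (set c) + exc_within F (set c)"
      using exc_within_cycle[OF F _ _ c(1-3), of "{}"] distinct_card[OF c(2)] by simp
    ultimately have "good (set c) c"
      using m c(4,5) xyl by (auto simp: good_def)
    then show ?thesis by blast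
  qed
  have step: "\<exists>S' ws'. good S' ws' \<and> S \<subset> S'" if g: "good S ws" and "S \<noteq> pverts H" for S ws
  proof -
    have SH: "S \<subseteq> pverts H" "finite S" and closed: "parcs F `` S \<subseteq> S" and uvS: "u \<in> S" "v \<in> S"
      using g H.pair_finite_verts finite_subset by (auto simp: good_def)
    obtain x y where "(x, y) \<in> (parcs H)\<^sup>s" and xy': "x \<in> S" "y \<in> pverts H" "y \<notin> S"
      using connected_crossing_arc[OF assms(2), of S] SH uvS \<open>S \<noteq> pverts H\<close>
      unfolding with_proj_simps by blast
    then have xy: "(x, y) \<in> parcs H" "x \<in> S" "y \<in> pverts H" "y \<notin> S"
      using H.arcs_symmetric by (auto simp: symcl_iff)
    have "x \<in> set ws"
      using g xy(2) by (simp add: good_def)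
    then obtain ws1 ws2 where ws: "ws = ws1 @ x # ws2"
      by (meson split_list)
    \<comment> \<open>The set \<open>S\<close> contains both \<open>u\<close> and \<open>v\<close>
      but not \<open>y\<close>, so this edge is not \<open>uv\<close>.\<close>
    have xyA: "(x, y) \<in> A" "(y, x) \<in> A"
      using xy H.arcs_symmetric uvS by (auto simp: A_def)
    \<comment> \<open>Splice the closed walk \<open>r\<close> between two copies of
      \<open>x\<close>: this adds the entries of \<open>r\<close> and one more
      \<open>x\<close>.\<close>
    have detour: "\<exists>ws'. ws' \<noteq> [] \<and> hd ws' = u \<and> last ws' = v \<and> set ws' = S \<union> set r \<and>
        set (vwalk_arcs ws') \<subseteq> A \<and> length ws' = length ws + length r + 1"
      if r: "r \<noteq> []" "hd r = y" "last r = y" "set (vwalk_arcs r) \<subseteq> A" for r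
    proof (intro exI[of _ "ws1 @ x # r @ x # ws2"] conjI)
      have "vwalk_arcs (x # r @ x # ws2) =
          (x, y) # vwalk_arcs r @ (y, x) # vwalk_arcs (x # ws2)"
        using vwalk_arcs_append[OF r(1), of "x # ws2"] r by simp
      moreover have "set (vwalk_arcs (ws1 @ [x])) \<union> set (vwalk_arcs (x # ws2)) \<subseteq> A"
        using g vwalk_arcs_split[of ws1 x ws2] by (auto simp: good_def ws)
      ultimately show "set (vwalk_arcs (ws1 @ x # r @ x # ws2)) \<subseteq> A"
        using vwalk_arcs_split[of ws1 x "r @ x # ws2"] xyA r(4) by auto
      show "hd (ws1 @ x # r @ x # ws2) = u"
        using g by (cases ws1) (auto simp: good_def ws)
      show "last (ws1 @ x # r @ x # ws2) = v"
        using g by (auto simp: good_def ws)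
      show "set (ws1 @ x # r @ x # ws2) = S \<union> set r"
        using g by (auto simp: good_def ws)
    qed (auto simp: ws)
    from deg[of y] xy(3) FH(1) consider "degree F y = 0" | "degree F y = 2" by auto
    then show ?thesis
    proof cases
      case 1
      \<comment> \<open>Of the two new entries, one is paid by \<open>card\<close> and one by the
        isolated vertex in the excess.\<close>
      obtain ws' where "ws' \<noteq> []" "hd ws' = u" "last ws' = v" "set ws' = S \<union> {y}"
        "set (vwalk_arcs ws') \<subseteq> A" "length ws' = length ws + 2"
        using detour[of "[y]"] by auto
      moreover have "parcs F `` {y} = {}"
        using 1 finite_Image[OF F.pair_finite_arcs, of "{y}"] by (simp add: degree_eq_card_Image)
      moreover have "length ws + 4 \<le> card (insert y S) + exc_within F (insert y S)"
        using exc_within_insert[OF F SH(2) xy(4) 1] g SH(2) xy(4) by (auto simp: good_def)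
      ultimately have "good (insert y S) ws'"
        using closed SH(1) uvS xy(3) by (auto simp: good_def)
      then show ?thesis
        using xy(4) by blast
    next
      case 2
      then have "parcs F `` {y} \<noteq> {}"
        by (auto simp: degree_eq_card_Image)
      then obtain z where "(y, z) \<in> parcs F" by blast
      then obtain c where c: "3 \<le> length c" "distinct c" "cycle_arcs c \<subseteq> parcs F" "hd c = y"
        using cycle_through_arc[OF F deg] by blast
      have c_closed: "parcs F `` set c \<subseteq> set c"
        using cycle_vertices_closed[OF F deg c(1-3)] by blast
      have sub: "set (vwalk_arcs (c @ [y])) \<subseteq> parcs F"
        using c(3,4) F.symcl_subset_parcs_iff by (simp add: cycle_arcs_def)
      \<comment> \<open>The set \<open>S\<close> is closed under the symmetric arcs of
        \<open>F\<close>, so a walk in \<open>F\<close> from \<open>y\<close> never enters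
        it.\<close>
      have "S \<inter> set (c @ [y]) = {}"
      proof (rule vwalk_disjoint)
        show "hd (c @ [y]) \<notin> S"
          using xy(4) c(4) by (cases c) auto
        fix a b assume "(a, b) \<in> set (vwalk_arcs (c @ [y]))" "b \<in> S"
        then show "a \<in> S"
          using closed sub F.arcs_symmetric[of a b] by blast
      qed simp
      then have disj: "S \<inter> set c = {}"
        by auto
      have cH: "set c \<subseteq> pverts H"
        using F.cycle_vertices_subset_pverts[OF c(1-3)] FH(1) by simp
      have "u \<notin> set c" "v \<notin> set c" "y \<in> set c" "c \<noteq> []"
        using disj uvS c(1,4) by (auto intro: hd_in_set)
      then have "set (vwalk_arcs (c @ [y])) \<subseteq> A"
        using sub FH(2) vwalk_arcs_subset[of "c @ [y]"] by (auto simp: A_def)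
      \<comment> \<open>Of the \<open>length c + 2\<close> new entries, \<open>length c\<close> are
        paid by \<open>card\<close> and 2 by the new cycle in the excess.\<close>
      then obtain ws' where ws': "ws' \<noteq> []" "hd ws' = u" "last ws' = v" "set ws' = S \<union> set c"
        "set (vwalk_arcs ws') \<subseteq> A" "length ws' = length ws + length c + 2"
        using detour[of "c @ [y]"] c(4) \<open>c \<noteq> []\<close> \<open>y \<in> set c\<close> by (auto simp: insert_absorb)
      have "card (S \<union> set c) = card S + length c"
        using disj SH(2) distinct_card[OF c(2)] by (simp add: card_Un_disjoint)
      then have "length ws' + 2 \<le> card (S \<union> set c) + exc_within F (S \<union> set c)"
        using exc_within_cycle[OF F SH(2) disj c(1-3)] ws'(6) g by (auto simp: good_def)
      then have "good (S \<union> set c) ws'"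
        using ws' closed c_closed SH(1) uvS cH by (auto simp: good_def Image_Un)
      then show ?thesis
        using xy(4) \<open>y \<in> set c\<close> by blast
    qed
  qed
  obtain ws where ws: "good (pverts H) ws"
  proof -
    let ?T = "{S. \<exists>ws. good S ws}"
    have "?T \<subseteq> Pow (pverts H)"
      unfolding good_def by blast
    then have "finite ?T"
      using H.pair_finite_verts finite_subset by blast
    moreover have "?T \<noteq> {}"
      using start by blast
    \<comment> \<open>A maximal visited set must be everything, since \<open>step\<close> would
      enlarge it.\<close>
    ultimately obtain S where S: "S \<in> ?T" "\<And>S'. S' \<in> ?T \<Longrightarrow> S \<subseteq> S' \<Longrightarrow> S = S'"
      using finite_has_maximal by metis
    then obtain ws where "good S ws" by blast
    moreover have "S = pverts H"
    proof (rule ccontr)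
      assume "S \<noteq> pverts H"
      then obtain S' ws' where "good S' ws'" "S \<subset> S'"
        using step[OF \<open>good S ws\<close>] by blast
      then show False
        using S(2)[of S'] by blast
    qed
    ultimately show thesis
      using that by blast
  qed
  show thesis
  proof (rule that)
    show "length ws + 2 \<le> num_verts H + exc F"
      using ws exc_within_pverts_le[OF F] FH(1) by (simp add: good_def num_verts_def)
  qed (use ws in \<open>simp_all add: good_def A_def\<close>)
qed

theorem lemma8:
  fixes H :: "'a pair_pre_digraph" and u v :: 'a and d :: real
  assumes "pair_graph H"
    and "two_connected H"
    and "subcubic H"
    and "(u, v) \<in> parcs H"
    and "deficit H (u, v) \<le> d"
  shows "\<exists>p. pre_digraph.awalk (with_proj (del_edge H (u, v))) u p v \<and>
             set (pre_digraph.awalk_verts (with_proj (del_edge H (u, v))) u p) = pverts H \<and>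
             real (length p) \<le> (5 * real (num_verts H) + real (num_deg2 H)) / 4 + d - 1"
proof -
  interpret H: pair_graph H by fact
  let ?E = "even_covers_with H (u, v)"
  have "Min (exc ` ?E) \<in> exc ` ?E"
    using finite_even_covers_with[OF assms(1)] two_connected_even_covers_with[OF assms(1,2,4)]
    by (intro Min_in) auto
  then obtain F where F: "even_cover H F" "(u, v) \<in> parcs F" "Min (exc ` ?E) = exc F"
    by (auto simp: even_covers_with_def)
  obtain ws where ws: "ws \<noteq> []" "hd ws = u" "last ws = v" "set ws = pverts H"
    "set (vwalk_arcs ws) \<subseteq> parcs H - {(u, v), (v, u)}" "length ws + 2 \<le> num_verts H + exc F"
    using even_cover_spanning_walk[OF assms(1) _ F(1,2)] assms(2) by (auto simp: two_connected_def)
  have "pre_digraph.awalk (with_proj (del_edge H (u, v))) u (vwalk_arcs ws) v"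
    using awalk_vwalk_arcs[of ws "del_edge H (u, v)"] ws H.in_arcsD1[OF assms(4)]
    by (auto simp: del_edge_def symcl_def)
  moreover have "pre_digraph.awalk_verts (with_proj (del_edge H (u, v))) u (vwalk_arcs ws) = ws"
    using pawalk_verts_vwalk_arcs[OF ws(1)] ws(2) by (simp add: awalk_verts_with_proj_eq)
  moreover have "real (length (vwalk_arcs ws)) \<le>
      (5 * real (num_verts H) + real (num_deg2 H)) / 4 + d - 1"
  proof -
    have "real (length (vwalk_arcs ws)) = real (length ws) - 1"
      using ws(1) by (cases ws) (auto simp: length_vwalk_arcs)
    moreover have "real (length ws) + 2 \<le> real (num_verts H) + real (exc F)"
      using ws(6) by linarith
    \<comment> \<open>The walk has length at most \<open>n + exc F - 3\<close>, and the deficit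
      bound gives \<open>exc F \<le> d + 2 + (n + n2) / 4\<close>, where \<open>n\<close> and
      \<open>n2\<close> are \<open>num_verts H\<close> and \<open>num_deg2 H\<close>.\<close>
    ultimately show ?thesis
      using assms(5) F(3) by (simp add: deficit_def rooted_exc_def field_simps)
  qed
  ultimately show ?thesis
    using ws(4) by auto
qed

end
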